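(* Let $\alpha$ be a continuous rotationally symmetric norm on $L^\infty(\mathbb T)$. Let $$G_\alpha=\{\varphi\in MP(\mathbb T):\ \alpha(h\circ\varphi)=\alpha(h)\ \text{for all } h\in L^\infty(\mathbb T)\}.$$ Let $g\in L^\alpha(\mathbb T)$, let $$K=\mathrm{co}\left(\{|g\circ\varphi|\,u:\ \|u\|_\infty\le1,\ \varphi\in G_\alpha\}\right),$$ and let $\overline K^{m}$ denote the closure of $K$ in the topology of convergence in measure. Suppose $\{f_n\}$ is a sequence with $|f_n|\in\overline K^{m}$ for every $n\in\mathbb N$ and $f_n\to f$ in measure. Then: (1) $f\in L^\alpha(\mathbb T)$, and (2) $\alpha(f_n-f)\to0$.
   Context: $\mathbb T$ is the unit circle and $m$ is normalized arc length (Haar measure) on $\mathbb T$; functions equal a.e. are identified. $MP(\mathbb T)$ is the set of invertible measure-preserving maps $\mathbb T\to\mathbb T$; $\mathrm{co}$ denotes convex hull; $u$ ranges over $L^\infty(\mathbb T)$ (complex-valued). For $w\in\mathbb T$, $f_w(z)=f(\overline wz)$. A continuous rotationally symmetric norm is a norm $\alpha$ on $L^\infty(\mathbb T)$ with $\alpha(1)=1$, $\alpha(|f|)=\alpha(f)$, $\alpha(f_w)=\alpha(f)$ for all $f\in L^\infty(\mathbb T)$, $w\in\mathbb T$, and $\lim_{m(E)\to0^+}\alpha(\chi_E)=0$. For any measurable $f:\mathbb T\to\mathbb C$ put $\alpha(f)=\sup\{\alpha(s):s\text{ a simple function},\ |s|\le|f|\}$. $\mathcal L^\alpha(\mathbb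 T)$ is the set of measurable $f$ with $\alpha(f)<\infty$, and $L^\alpha(\mathbb T)$ is the $\alpha$-closure of $L^\infty(\mathbb T)$ in $\mathcal L^\alpha(\mathbb T)$. *)

theory Defs
  imports "HOL-Probability.Probability" "HOL-Library.Function_Algebras"
begin

text \<open>Pointwise real scalar multiplication of functions; together with the pointwise addition of
  \<^theory>\<open>HOL-Library.Function_Algebras\<close> it makes the library's \<open>convex hull\<close> available for
  sets of functions.\<close>

instantiation "fun" :: (type, real_vector) real_vector
begin

definition scaleR_fun :: "real \<Rightarrow> ('a \<Rightarrow> 'b) \<Rightarrow> 'a \<Rightarrow> 'b"
  where "scaleR_fun c f = (\<lambda>x. c *\<^sub>R f x)"

instance
  by standard (simp_all add: fun_eq_iff scaleR_fun_def scaleR_add_right scaleR_add_left)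

end

definition arc_measure :: "complex measure"
  where "arc_measure =
    completion (distr (uniform_measure lborel {0..<2 * pi}) (restrict_space borel (sphere 0 1)) cis)"

lemma space_arc_measure: "space arc_measure = sphere 0 1"
  by (simp add: arc_measure_def space_restrict_space)

lemma prob_space_arc_measure: "prob_space arc_measure"
proof -
  interpret U: prob_space "uniform_measure lborel {0..<2 * pi}"
    by (rule prob_space_uniform_measure) auto
  have "cis \<in> borel_measurable borel"
    by (intro borel_measurable_continuous_onI continuous_intros)
  then have "cis \<in> uniform_measure lborel {0..<2 * pi} \<rightarrow>\<^sub>M restrict_space borel (sphere 0 1)"
    by (intro measurable_restrict_space2) auto
  then interpret D: prob_space
      "distr (uniform_measure lborel {0..<2 * pi}) (restrict_space borel (sphere 0 1)) cis"
    by (rule U.prob_space_distr)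
  show ?thesis
    unfolding arc_measure_def by (rule D.prob_space_completion)
qed

text \<open>Elements of function spaces over the circle are represented by functions
  \<^typ>\<open>complex \<Rightarrow> complex\<close>, of which only the values on the circle, up to null sets, matter.\<close>

definition Linfty_norm :: "(complex \<Rightarrow> complex) \<Rightarrow> ereal"
  where "Linfty_norm f = esssup arc_measure (\<lambda>z. ereal (cmod (f z)))"

definition Linfty :: "(complex \<Rightarrow> complex) set"
  where "Linfty = {f \<in> borel_measurable arc_measure. Linfty_norm f < \<infinity>}"

text \<open>Since functions equal a.e. are identified, definiteness of \<open>\<alpha>\<close> refers to functions vanishing
  a.e.; with the triangle inequality this makes \<open>\<alpha>\<close> invariant under changes on null sets.\<close>

definition continuous_rotsym_norm :: "((complex \<Rightarrow> complex) \<Rightarrow> real) \<Rightarrow> bool"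
  where "continuous_rotsym_norm \<alpha> \<longleftrightarrow>
    (\<forall>f\<in>Linfty. 0 \<le> \<alpha> f \<and> (\<alpha> f = 0 \<longleftrightarrow> (AE z in arc_measure. f z = 0))) \<and>
    (\<forall>f\<in>Linfty. \<forall>c. \<alpha> (\<lambda>z. c * f z) = cmod c * \<alpha> f) \<and>
    (\<forall>f\<in>Linfty. \<forall>g\<in>Linfty. \<alpha> (\<lambda>z. f z + g z) \<le> \<alpha> f + \<alpha> g) \<and>
    \<alpha> (\<lambda>_. 1) = 1 \<and>
    (\<forall>f\<in>Linfty. \<alpha> (\<lambda>z. complex_of_real (cmod (f z))) = \<alpha> f) \<and>
    (\<forall>f\<in>Linfty. \<forall>w\<in>sphere 0 1. \<alpha> (\<lambda>z. f (cnj w * z)) = \<alpha> f) \<and>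
    (\<forall>\<epsilon>>0. \<exists>\<delta>>0. \<forall>E\<in>sets arc_measure.
       0 < measure arc_measure E \<and> measure arc_measure E < \<delta> \<longrightarrow> \<alpha> (indicator E) < \<epsilon>)"

definition ext_norm :: "((complex \<Rightarrow> complex) \<Rightarrow> real) \<Rightarrow> (complex \<Rightarrow> complex) \<Rightarrow> ereal"
  where "ext_norm \<alpha> f =
    (SUP s\<in>{s. simple_function arc_measure s \<and> (AE z in arc_measure. cmod (s z) \<le> cmod (f z))}.
       ereal (\<alpha> s))"

definition cal_L :: "((complex \<Rightarrow> complex) \<Rightarrow> real) \<Rightarrow> (complex \<Rightarrow> complex) set"
  where "cal_L \<alpha> = {f \<in> borel_measurable arc_measure. ext_norm \<alpha> f < \<infinity>}"

definition L_space :: "((complex \<Rightarrow> complex) \<Rightarrow> real) \<Rightarrow> (complex \<Rightarrow> complex) set"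
  where "L_space \<alpha> =
    {f \<in> cal_L \<alpha>. \<forall>\<epsilon>>0. \<exists>h\<in>Linfty. ext_norm \<alpha> (\<lambda>z. f z - h z) < ereal \<epsilon>}"

text \<open>Invertibility is understood modulo null sets, in accordance with the identification of
  functions that agree a.e.\<close>

definition MP :: "(complex \<Rightarrow> complex) set"
  where "MP = {\<phi> \<in> arc_measure \<rightarrow>\<^sub>M arc_measure.
    distr arc_measure arc_measure \<phi> = arc_measure \<and>
    (\<exists>\<psi> \<in> arc_measure \<rightarrow>\<^sub>M arc_measure.
       distr arc_measure arc_measure \<psi> = arc_measure \<and>
       (AE z in arc_measure. \<psi> (\<phi> z) = z) \<and> (AE z in arc_measure. \<phi> (\<psi> z) = z))}"

definition G_set :: "((complex \<Rightarrow> complex) \<Rightarrow> real) \<Rightarrow> (complex \<Rightarrow> complex) set"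
  where "G_set \<alpha> = {\<phi> \<in> MP. \<forall>h\<in>Linfty. \<alpha> (h \<circ> \<phi>) = \<alpha> h}"

definition tendsto_in_measure ::
    "(nat \<Rightarrow> complex \<Rightarrow> complex) \<Rightarrow> (complex \<Rightarrow> complex) \<Rightarrow> bool"
  where "tendsto_in_measure X f \<longleftrightarrow>
    (\<forall>n. X n \<in> borel_measurable arc_measure) \<and> f \<in> borel_measurable arc_measure \<and>
    (\<forall>\<epsilon>>0. (\<lambda>n. measure arc_measure {z \<in> space arc_measure. \<epsilon> \<le> cmod (X n z - f z)})
             \<longlonglongrightarrow> 0)"

text \<open>The topology of convergence in measure lives on the measurable functions; the sets
  \<^term>\<open>measure_nbhd f \<epsilon>\<close> form a neighbourhood base at \<^term>\<open>f\<close>.\<close>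

definition measure_nbhd :: "(complex \<Rightarrow> complex) \<Rightarrow> real \<Rightarrow> (complex \<Rightarrow> complex) set"
  where "measure_nbhd f \<epsilon> = {k \<in> borel_measurable arc_measure.
    measure arc_measure {z \<in> space arc_measure. \<epsilon> \<le> cmod (k z - f z)} < \<epsilon>}"

definition measure_topology :: "(complex \<Rightarrow> complex) topology"
  where "measure_topology = topology (\<lambda>U. U \<subseteq> borel_measurable arc_measure \<and>
    (\<forall>f\<in>U. \<exists>\<epsilon>>0. measure_nbhd f \<epsilon> \<subseteq> U))"

lemma measure_nbhd_mono:
  assumes "f \<in> borel_measurable arc_measure" "\<delta> \<le> \<epsilon>"
  shows "measure_nbhd f \<delta> \<subseteq> measure_nbhd f \<epsilon>"
proof
  interpret prob_space arc_measure by (rule prob_space_arc_measure)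
  note [measurable] = assms(1)
  fix k assume k: "k \<in> measure_nbhd f \<delta>"
  then have [measurable]: "k \<in> borel_measurable arc_measure"
    by (simp add: measure_nbhd_def)
  have "measure arc_measure {z \<in> space arc_measure. \<epsilon> \<le> cmod (k z - f z)}
      \<le> measure arc_measure {z \<in> space arc_measure. \<delta> \<le> cmod (k z - f z)}"
    using assms(2) by (intro finite_measure_mono) auto
  with k assms(2) show "k \<in> measure_nbhd f \<epsilon>"
    by (simp add: measure_nbhd_def)
qed

lemma openin_measure_topology:
  "openin measure_topology U \<longleftrightarrow> U \<subseteq> borel_measurable arc_measure \<and>
    (\<forall>f\<in>U. \<exists>\<epsilon>>0. measure_nbhd f \<epsilon> \<subseteq> U)"
proof -
  have "istopology (\<lambda>U. U \<subseteq> borel_measurable arc_measure \<and>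
      (\<forall>f\<in>U. \<exists>\<epsilon>>0. measure_nbhd f \<epsilon> \<subseteq> U))" (is "istopology ?P")
    unfolding istopology_def
  proof (intro conjI allI impI)
    fix S T assume S: "?P S" and T: "?P T"
    then show "S \<inter> T \<subseteq> borel_measurable arc_measure" by blast
    show "\<forall>f\<in>S \<inter> T. \<exists>\<epsilon>>0. measure_nbhd f \<epsilon> \<subseteq> S \<inter> T"
    proof
      fix f assume f: "f \<in> S \<inter> T"
      then obtain a b where ab: "a > 0" "measure_nbhd f a \<subseteq> S" "b > 0" "measure_nbhd f b \<subseteq> T"
        using S T by blast
      have "f \<in> borel_measurable arc_measure"
        using f S by blast
      then have "measure_nbhd f (min a b) \<subseteq> S \<inter> T"
        using ab measure_nbhd_mono[of f "min a b" a] measure_nbhd_mono[of f "min a b" b] by auto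
      then show "\<exists>\<epsilon>>0. measure_nbhd f \<epsilon> \<subseteq> S \<inter> T"
        using ab by (intro exI[of _ "min a b"]) auto
    qed
  next
    fix \<K> assume K: "\<forall>S\<in>\<K>. ?P S"
    then show "\<Union>\<K> \<subseteq> borel_measurable arc_measure" by blast
    show "\<forall>f\<in>\<Union>\<K>. \<exists>\<epsilon>>0. measure_nbhd f \<epsilon> \<subseteq> \<Union>\<K>"
      using K by (meson Union_iff Union_upper subset_trans)
  qed
  then show ?thesis
    by (simp add: measure_topology_def topology_inverse')
qed

lemma topspace_measure_topology: "topspace measure_topology = borel_measurable arc_measure"
proof
  show "topspace measure_topology \<subseteq> borel_measurable arc_measure"
    using openin_topspace openin_measure_topology by blast
  have "openin measure_topology (borel_measurable arc_measure)"
    unfolding openin_measure_topology by (auto simp: measure_nbhd_def intro: exI[of _ 1])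
  then show "borel_measurable arc_measure \<subseteq> topspace measure_topology"
    by (rule openin_subset)
qed

text \<open>Sanity check: the basic sets really are neighbourhoods, and closure has the expected
  \<open>\<epsilon>\<close>-description.\<close>

lemma measure_topology_nbhd:
  assumes f: "f \<in> borel_measurable arc_measure" and "\<epsilon> > 0"
  shows "\<exists>U. openin measure_topology U \<and> f \<in> U \<and> U \<subseteq> measure_nbhd f \<epsilon>"
proof -
  interpret prob_space arc_measure by (rule prob_space_arc_measure)
  note [measurable] = f
  define U where "U = {k \<in> borel_measurable arc_measure. \<exists>a>0. \<exists>b>0. a + b \<le> \<epsilon> \<and>
    measure arc_measure {z \<in> space arc_measure. a \<le> cmod (k z - f z)} < a}"
  have "f \<in> U"
    unfolding U_def using \<open>\<epsilon> > 0\<close> f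
    by (auto intro!: exI[of _ "\<epsilon>/2"])
  moreover have "U \<subseteq> measure_nbhd f \<epsilon>"
  proof
    fix k assume "k \<in> U"
    then obtain a b where "a > 0" "b > 0" "a + b \<le> \<epsilon>" "k \<in> measure_nbhd f a"
      by (auto simp: U_def measure_nbhd_def)
    then show "k \<in> measure_nbhd f \<epsilon>"
      using measure_nbhd_mono[OF f, of a \<epsilon>] by auto
  qed
  moreover have "openin measure_topology U"
    unfolding openin_measure_topology
  proof (intro conjI ballI)
    show "U \<subseteq> borel_measurable arc_measure" by (auto simp: U_def)
    fix k assume "k \<in> U"
    then obtain a b where ab: "a > 0" "b > 0" "a + b \<le> \<epsilon>"
      and k[measurable]: "k \<in> borel_measurable arc_measure"
      and ka: "measure arc_measure {z \<in> space arc_measure. a \<le> cmod (k z - f z)} < a"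
      by (auto simp: U_def)
    define c where "c = b / 2"
    have "measure_nbhd k c \<subseteq> U"
    proof
      fix h assume "h \<in> measure_nbhd k c"
      then have h[measurable]: "h \<in> borel_measurable arc_measure"
        and hc: "measure arc_measure {z \<in> space arc_measure. c \<le> cmod (h z - k z)} < c"
        by (auto simp: measure_nbhd_def)
      have "{z \<in> space arc_measure. a + c \<le> cmod (h z - f z)} \<subseteq>
          {z \<in> space arc_measure. a \<le> cmod (k z - f z)} \<union>
          {z \<in> space arc_measure. c \<le> cmod (h z - k z)}"
      proof
        fix z assume z: "z \<in> {z \<in> space arc_measure. a + c \<le> cmod (h z - f z)}"
        have "cmod (h z - f z) \<le> cmod (h z - k z) + cmod (k z - f z)"
          using norm_triangle_ineq[of "h z - k z" "k z - f z"] by simp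
        with z show "z \<in> {z \<in> space arc_measure. a \<le> cmod (k z - f z)} \<union>
          {z \<in> space arc_measure. c \<le> cmod (h z - k z)}" by auto
      qed
      then have "measure arc_measure {z \<in> space arc_measure. a + c \<le> cmod (h z - f z)} \<le>
          measure arc_measure ({z \<in> space arc_measure. a \<le> cmod (k z - f z)} \<union>
          {z \<in> space arc_measure. c \<le> cmod (h z - k z)})"
        by (intro finite_measure_mono) auto
      also have "\<dots> \<le> measure arc_measure {z \<in> space arc_measure. a \<le> cmod (k z - f z)} +
          measure arc_measure {z \<in> space arc_measure. c \<le> cmod (h z - k z)}"
        by (intro measure_Un_le) auto
      finally have "measure arc_measure {z \<in> space arc_measure. a + c \<le> cmod (h z - f z)} < a + c"
        using ka hc by simp
      moreover have "0 < a + c" "0 < c" "(a + c) + c \<le> \<epsilon>"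
        using ab by (auto simp: c_def)
      ultimately show "h \<in> U"
        unfolding U_def using h by blast
    qed
    then show "\<exists>\<epsilon>>0. measure_nbhd k \<epsilon> \<subseteq> U"
      using ab by (intro exI[of _ c]) (auto simp: c_def)
  qed
  ultimately show ?thesis by blast
qed

lemma in_closure_measure_topology:
  "f \<in> measure_topology closure_of K \<longleftrightarrow>
    f \<in> borel_measurable arc_measure \<and> (\<forall>\<epsilon>>0. \<exists>k\<in>K. k \<in> measure_nbhd f \<epsilon>)"
proof (intro iffI conjI allI impI)
  assume f: "f \<in> measure_topology closure_of K"
  then show m: "f \<in> borel_measurable arc_measure"
    by (simp add: in_closure_of topspace_measure_topology)
  fix \<epsilon> :: real assume "\<epsilon> > 0"
  from measure_topology_nbhd[OF m this] f show "\<exists>k\<in>K. k \<in> measure_nbhd f \<epsilon>"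
    unfolding in_closure_of by blast
next
  assume f: "f \<in> borel_measurable arc_measure \<and> (\<forall>\<epsilon>>0. \<exists>k\<in>K. k \<in> measure_nbhd f \<epsilon>)"
  then show "f \<in> measure_topology closure_of K"
    unfolding in_closure_of topspace_measure_topology openin_measure_topology by blast
qed

end

theory Submission
  imports Defs
begin

text \<open>Every \<open>g \<in> L\<^sup>\<alpha>\<close> has uniformly small tails: \<open>\<alpha>((|g| - M)\<^sup>+) \<le> \<epsilon>\<close> for a suitable \<open>M\<close>. Composition
  with maps in \<open>G\<^sub>\<alpha>\<close>, multiplication by functions bounded by \<open>1\<close>, convex combinations and, by a Fatou
  argument, limits in measure all preserve this inequality with the same \<open>M\<close> and \<open>\<epsilon>\<close>. Hence it holds
  for all \<open>f\<^sub>n\<close> and for \<open>f\<close>, and the conclusion follows as in Vitali's convergence theorem from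
  \<open>|f\<^sub>n - f| \<le> \<delta> + 2 M \<chi>\<^sub>E + (|f\<^sub>n| - M)\<^sup>+ + (|f| - M)\<^sup>+\<close> with \<open>E = {|f\<^sub>n - f| \<ge> \<delta>}\<close>.\<close>

section \<open>Essentially bounded functions on the circle\<close>

interpretation arc: prob_space arc_measure
  by (rule prob_space_arc_measure)

text \<open>The essential supremum is itself an a.e. bound. A bound can be enlarged, so it is taken
  positive; later estimates divide by it.\<close>

lemma Linfty_iff:
  "f \<in> Linfty \<longleftrightarrow> f \<in> borel_measurable arc_measure \<and> (\<exists>b>0. AE z in arc_measure. cmod (f z) \<le> b)"
proof (intro iffI conjI)
  assume f: "f \<in> Linfty"
  then show "f \<in> borel_measurable arc_measure"
    by (simp add: Linfty_def)
  have "AE z in arc_measure. ereal (cmod (f z)) \<le> Linfty_norm f"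
    unfolding Linfty_norm_def by (rule esssup_AE)
  moreover obtain b where b: "Linfty_norm f \<le> ereal b" "b > 0"
  proof (cases "Linfty_norm f")
    case (real r)
    then show thesis using that[of "max r 1"] by simp
  next
    case PInf
    then show thesis using f by (simp add: Linfty_def)
  next
    case MInf
    then show thesis using that[of 1] by simp
  qed
  ultimately have "AE z in arc_measure. cmod (f z) \<le> b"
    by (auto elim!: eventually_mono dest: order_trans)
  with b show "\<exists>b>0. AE z in arc_measure. cmod (f z) \<le> b" by blast
next
  assume f: "f \<in> borel_measurable arc_measure \<and> (\<exists>b>0. AE z in arc_measure. cmod (f z) \<le> b)"
  then obtain b where b: "AE z in arc_measure. cmod (f z) \<le> b" by blast
  from f have [measurable]: "f \<in> borel_measurable arc_measure" by blast
  have "Linfty_norm f \<le> ereal b"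
    unfolding Linfty_norm_def by (rule esssup_I) (use b in auto)
  then show "f \<in> Linfty"
    using f by (auto simp: Linfty_def)
qed

lemma Linfty_measurable [measurable_dest]:
  "f \<in> Linfty \<Longrightarrow> f \<in> borel_measurable arc_measure"
  by (simp add: Linfty_iff)

lemma LinftyI:
  assumes "f \<in> borel_measurable arc_measure" "AE z in arc_measure. cmod (f z) \<le> b"
  shows "f \<in> Linfty"
proof -
  have "AE z in arc_measure. cmod (f z) \<le> max b 1"
    using assms(2) by (auto elim!: eventually_mono)
  then show ?thesis
    unfolding Linfty_iff using assms(1) by (intro conjI exI[of _ "max b 1"]) auto
qed

lemma LinftyE:
  assumes "f \<in> Linfty"
  obtains b where "b > 0" "AE z in arc_measure. cmod (f z) \<le> b"
  using assms by (auto simp: Linfty_iff)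

lemma Linfty_dominated:
  assumes "h \<in> Linfty" "f \<in> borel_measurable arc_measure"
    "AE z in arc_measure. cmod (f z) \<le> cmod (h z)"
  shows "f \<in> Linfty"
proof -
  obtain b where "AE z in arc_measure. cmod (h z) \<le> b" using assms(1) by (rule LinftyE)
  with assms(3) have "AE z in arc_measure. cmod (f z) \<le> b" by eventually_elim simp
  with assms(2) show ?thesis by (rule LinftyI)
qed

lemma Linfty_const: "(\<lambda>_. c) \<in> Linfty"
  by (rule LinftyI[of _ "cmod c"]) auto

lemma Linfty_add:
  assumes "f \<in> Linfty" "h \<in> Linfty"
  shows "(\<lambda>z. f z + h z) \<in> Linfty"
proof -
  note [measurable] = assms
  obtain a b where "AE z in arc_measure. cmod (f z) \<le> a" "AE z in arc_measure. cmod (h z) \<le> b"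
    using LinftyE[OF assms(1)] LinftyE[OF assms(2)] by metis
  then have "AE z in arc_measure. cmod (f z + h z) \<le> a + b"
    by eventually_elim (rule order_trans[OF norm_triangle_ineq], simp)
  then show ?thesis by (rule LinftyI[rotated]) measurable
qed

lemma Linfty_cmult:
  assumes "f \<in> Linfty"
  shows "(\<lambda>z. c * f z) \<in> Linfty"
proof -
  note [measurable] = assms
  obtain a where "AE z in arc_measure. cmod (f z) \<le> a"
    using assms by (rule LinftyE)
  then have "AE z in arc_measure. cmod (c * f z) \<le> cmod c * a"
    by eventually_elim (simp add: norm_mult mult_left_mono)
  then show ?thesis by (rule LinftyI[rotated]) measurable
qed

lemma Linfty_indicator: "E \<in> sets arc_measure \<Longrightarrow> indicator E \<in> Linfty"
  by (rule LinftyI[of _ 1]) (auto simp: indicator_def)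

lemma Linfty_simple_function:
  assumes "simple_function arc_measure s"
  shows "s \<in> Linfty"
proof -
  have fin: "finite (s ` space arc_measure)"
    using assms by (simp add: simple_function_def)
  have "AE z in arc_measure. cmod (s z) \<le> Max (cmod ` s ` space arc_measure)"
    by (rule AE_I2) (use fin in auto)
  moreover have "s \<in> borel_measurable arc_measure"
    using assms by (rule borel_measurable_simple_function)
  ultimately show ?thesis by (rule LinftyI[rotated])
qed

text \<open>The exceptional set of \<open>P\<close> lies in a null set, whose preimage under the
  measure-preserving \<phi> is again null.\<close>

lemma AE_arc_compose:
  assumes \<phi>: "\<phi> \<in> arc_measure \<rightarrow>\<^sub>M arc_measure" "distr arc_measure arc_measure \<phi> = arc_measure"
    and P: "AE z in arc_measure. P z"
  shows "AE z in arc_measure. P (\<phi> z)"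
proof -
  obtain N where N: "N \<in> null_sets arc_measure" "{z \<in> space arc_measure. \<not> P z} \<subseteq> N"
    using P unfolding eventually_ae_filter by blast
  have "emeasure arc_measure (\<phi> -` N \<inter> space arc_measure) = emeasure arc_measure N"
    using emeasure_distr[OF \<phi>(1), of N] N(1) \<phi>(2) by auto
  then have "\<phi> -` N \<inter> space arc_measure \<in> null_sets arc_measure"
    using N(1) \<phi>(1) by (auto simp: null_sets_def measurable_sets)
  moreover have "{z \<in> space arc_measure. \<not> P (\<phi> z)} \<subseteq> \<phi> -` N \<inter> space arc_measure"
    using N(2) measurable_space[OF \<phi>(1)] by auto
  ultimately show ?thesis by (rule AE_I')
qed

section \<open>Upper bounds for \<alpha> through bounded minorants\<close>

text \<open>A real-valued substitute for \<open>\<alpha>(p) \<le> C\<close> that tests \<open>p\<close> against all bounded minorants instead of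
  only the simple ones, so that minorants may be multiplied by arbitrary bounded functions.\<close>

definition alpha_bound :: "((complex \<Rightarrow> complex) \<Rightarrow> real) \<Rightarrow> (complex \<Rightarrow> real) \<Rightarrow> real \<Rightarrow> bool"
  where "alpha_bound \<alpha> p C \<longleftrightarrow>
    (\<forall>s\<in>Linfty. (AE z in arc_measure. cmod (s z) \<le> p z) \<longrightarrow> \<alpha> s \<le> C)"

lemma alpha_boundD:
  "alpha_bound \<alpha> p C \<Longrightarrow> s \<in> Linfty \<Longrightarrow> AE z in arc_measure. cmod (s z) \<le> p z \<Longrightarrow> \<alpha> s \<le> C"
  by (simp add: alpha_bound_def)

lemma alpha_bound_mono:
  assumes "alpha_bound \<alpha> q C" "AE z in arc_measure. p z \<le> q z" "C \<le> D"
  shows "alpha_bound \<alpha> p D"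
  unfolding alpha_bound_def
proof (intro ballI impI)
  fix s assume "s \<in> Linfty" and "AE z in arc_measure. cmod (s z) \<le> p z"
  from this(2) assms(2) have "AE z in arc_measure. cmod (s z) \<le> q z" by eventually_elim simp
  with assms(1) \<open>s \<in> Linfty\<close> have "\<alpha> s \<le> C" by (rule alpha_boundD)
  with assms(3) show "\<alpha> s \<le> D" by simp
qed

text \<open>Simple functions are bounded, so each minorant in the supremum is among those tested by
  \<open>alpha_bound\<close>. The converse comparison is
  \<open>alpha_bound_ext_norm\<close>.\<close>

lemma ext_norm_le_alpha_bound:
  assumes "alpha_bound \<alpha> (\<lambda>z. cmod (f z)) C"
  shows "ext_norm \<alpha> f \<le> ereal C"
  unfolding ext_norm_def
  using assms by (intro SUP_least) (auto intro: alpha_boundD[OF assms] Linfty_simple_function)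

section \<open>Null-set invariance and monotonicity of \<alpha>\<close>

locale rotsym_norm =
  fixes \<alpha> :: "(complex \<Rightarrow> complex) \<Rightarrow> real"
  assumes rotsym_norm: "continuous_rotsym_norm \<alpha>"
begin

lemma alpha_eq_0_iff: "f \<in> Linfty \<Longrightarrow> \<alpha> f = 0 \<longleftrightarrow> (AE z in arc_measure. f z = 0)"
  and alpha_cmult: "f \<in> Linfty \<Longrightarrow> \<alpha> (\<lambda>z. c * f z) = cmod c * \<alpha> f"
  and alpha_add: "f \<in> Linfty \<Longrightarrow> h \<in> Linfty \<Longrightarrow> \<alpha> (\<lambda>z. f z + h z) \<le> \<alpha> f + \<alpha> h"
  and alpha_one: "\<alpha> (\<lambda>_. 1) = 1"
  and alpha_cmod: "f \<in> Linfty \<Longrightarrow> \<alpha> (\<lambda>z. complex_of_real (cmod (f z))) = \<alpha> f"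
  using rotsym_norm by (auto simp: continuous_rotsym_norm_def)

text \<open>Write \<open>f = h + (f - h)\<close>: the difference vanishes a.e., so definiteness
  gives it norm 0, and the triangle inequality does the rest.\<close>

lemma alpha_cong_AE_le:
  assumes f: "f \<in> Linfty" and h: "h \<in> Linfty" and eq: "AE z in arc_measure. f z = h z"
  shows "\<alpha> f \<le> \<alpha> h"
proof -
  have d: "(\<lambda>z. f z + (- 1) * h z) \<in> Linfty"
    using f h by (intro Linfty_add Linfty_cmult)
  have "AE z in arc_measure. f z + (- 1) * h z = 0"
    using eq by eventually_elim simp
  with alpha_eq_0_iff[OF d] have "\<alpha> (\<lambda>z. f z + (- 1) * h z) = 0" by simp
  with alpha_add[OF h d] show ?thesis by simp
qed

lemma alpha_cong_AE:
  assumes "f \<in> Linfty" "h \<in> Linfty" "AE z in arc_measure. f z = h z"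
  shows "\<alpha> f = \<alpha> h"
proof (rule antisym)
  have "AE z in arc_measure. h z = f z" using assms(3) by eventually_elim simp
  with assms show "\<alpha> h \<le> \<alpha> f" by (intro alpha_cong_AE_le)
qed (intro alpha_cong_AE_le assms)

text \<open>A factor \<open>c \<in> [0, 1]\<close> is the mean of the two unimodular numbers \<open>c \<plusminus> i \<surd>(1 - c\<^sup>2)\<close>, and
  multiplication by a unimodular function does not change \<open>\<alpha>\<close>.\<close>

lemma alpha_mono:
  assumes f: "f \<in> Linfty" and h: "h \<in> Linfty"
    and le: "AE z in arc_measure. cmod (f z) \<le> cmod (h z)"
  shows "\<alpha> f \<le> \<alpha> h"
proof -
  note [measurable] = f h
  \<comment> \<open>Where \<open>le\<close> holds, \<open>|h| * c = |f|\<close>; at zeros of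
    \<open>h\<close> division by 0 gives \<open>c z = 0\<close>, and \<open>f\<close> vanishes there
    too. The minimum keeps \<open>c\<close> within [0, 1] on the exceptional null set as
    well.\<close>
  define c where "c z = min 1 (cmod (f z) / cmod (h z))" for z
  have [measurable]: "c \<in> borel_measurable arc_measure"
    unfolding c_def by measurable
  have c: "0 \<le> c z" "c z \<le> 1" for z
    by (auto simp: c_def)
  define k where "k \<sigma> z = complex_of_real (cmod (h z)) * Complex (c z) (\<sigma> * sqrt (1 - (c z)\<^sup>2))"
    for \<sigma> z
  have k_meas [measurable]: "k \<sigma> \<in> borel_measurable arc_measure" for \<sigma>
    unfolding k_def Complex_eq by measurable
  have cmod_k: "cmod (k \<sigma> z) = cmod (h z)" if "\<sigma> = 1 \<or> \<sigma> = - 1" for \<sigma> z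
  proof -
    have "(c z)\<^sup>2 \<le> 1"
      using c[of z] by (simp add: abs_square_le_1)
    with that have "cmod (Complex (c z) (\<sigma> * sqrt (1 - (c z)\<^sup>2))) = 1"
      by (auto simp: cmod_def power_mult_distrib)
    then show ?thesis by (simp add: k_def norm_mult)
  qed
  have kL: "k \<sigma> \<in> Linfty" if "\<sigma> = 1 \<or> \<sigma> = - 1" for \<sigma>
    by (rule Linfty_dominated[OF h k_meas]) (use cmod_k[OF that] in auto)
  have \<alpha>k: "\<alpha> (k \<sigma>) = \<alpha> h" if "\<sigma> = 1 \<or> \<sigma> = - 1" for \<sigma>
    using alpha_cmod[OF kL[OF that]] alpha_cmod[OF h] cmod_k[OF that] by simp
  have sum: "(\<lambda>z. k 1 z + k (- 1) z) \<in> Linfty"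
    by (intro Linfty_add kL) auto
  have fL: "(\<lambda>z. complex_of_real (cmod (f z))) \<in> Linfty"
    by (rule Linfty_dominated[OF f]) auto
  have "\<alpha> f = \<alpha> (\<lambda>z. complex_of_real (cmod (f z)))"
    using alpha_cmod[OF f] by simp
  also have "\<dots> = \<alpha> (\<lambda>z. (1 / 2) * (k 1 z + k (- 1) z))"
  proof (rule alpha_cong_AE[OF fL Linfty_cmult[OF sum]])
    show "AE z in arc_measure. complex_of_real (cmod (f z)) = (1 / 2) * (k 1 z + k (- 1) z)"
      using le
    proof eventually_elim
      case (elim z)
      have "cmod (h z) * c z = cmod (f z)"
        using elim by (cases "h z = 0") (auto simp: c_def min_def field_simps)
      then show ?case
        by (simp add: k_def complex_eq_iff algebra_simps)
    qed
  qed
  also have "\<dots> = (1 / 2) * \<alpha> (\<lambda>z. k 1 z + k (- 1) z)"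
    using alpha_cmult[OF sum, of "1 / 2"] by simp
  also have "\<dots> \<le> (1 / 2) * (\<alpha> (k 1) + \<alpha> (k (- 1)))"
    using alpha_add[of "k 1" "k (- 1)"] kL by simp
  also have "\<dots> = \<alpha> h"
    using \<alpha>k by simp
  finally show ?thesis .
qed

section \<open>Rules for bounds, and comparison with the extended norm\<close>

lemma alpha_bound_Linfty:
  assumes "h \<in> Linfty"
  shows "alpha_bound \<alpha> (\<lambda>z. cmod (h z)) (\<alpha> h)"
  unfolding alpha_bound_def using assms by (auto intro: alpha_mono)

text \<open>The inverse \<psi> carries a bounded minorant \<open>s\<close> of
  \<open>p \<circ> \<phi>\<close> to the minorant \<open>s \<circ> \<psi>\<close> of
  \<open>p\<close>. Composing back with \<phi> preserves \<alpha> and recovers \<open>s\<close>,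
  though only a.e.\<close>

lemma alpha_bound_compose:
  assumes p: "alpha_bound \<alpha> p C" and \<phi>: "\<phi> \<in> G_set \<alpha>"
  shows "alpha_bound \<alpha> (\<lambda>z. p (\<phi> z)) C"
  unfolding alpha_bound_def
proof (intro ballI impI)
  fix s assume s: "s \<in> Linfty" and le: "AE z in arc_measure. cmod (s z) \<le> p (\<phi> z)"
  obtain \<psi> where \<psi>: "\<psi> \<in> arc_measure \<rightarrow>\<^sub>M arc_measure"
    and d\<psi>: "distr arc_measure arc_measure \<psi> = arc_measure"
    and inv: "AE z in arc_measure. \<psi> (\<phi> z) = z" "AE z in arc_measure. \<phi> (\<psi> z) = z"
    using \<phi> by (auto simp: G_set_def MP_def)
  have \<phi>m: "\<phi> \<in> arc_measure \<rightarrow>\<^sub>M arc_measure"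
    and inva: "\<And>h. h \<in> Linfty \<Longrightarrow> \<alpha> (h \<circ> \<phi>) = \<alpha> h"
    using \<phi> by (auto simp: G_set_def MP_def)
  obtain b where b: "AE z in arc_measure. cmod (s z) \<le> b"
    using s by (rule LinftyE)
  have s\<psi>: "s \<circ> \<psi> \<in> Linfty"
  proof (rule LinftyI)
    show "s \<circ> \<psi> \<in> borel_measurable arc_measure"
      using measurable_comp[OF \<psi> Linfty_measurable[OF s]] .
    show "AE z in arc_measure. cmod ((s \<circ> \<psi>) z) \<le> b"
      using AE_arc_compose[OF \<psi> d\<psi> b] by simp
  qed
  have "AE z in arc_measure. cmod (s (\<psi> z)) \<le> p (\<phi> (\<psi> z))"
    by (rule AE_arc_compose[OF \<psi> d\<psi> le])
  with inv(2) have "AE z in arc_measure. cmod ((s \<circ> \<psi>) z) \<le> p z"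
    by eventually_elim simp
  with p s\<psi> have "\<alpha> (s \<circ> \<psi>) \<le> C" by (rule alpha_boundD)
  moreover have "\<alpha> (s \<circ> \<psi> \<circ> \<phi>) = \<alpha> s"
  proof (rule alpha_cong_AE)
    have "AE z in arc_measure. cmod ((s \<circ> \<psi> \<circ> \<phi>) z) \<le> b"
      using inv(1) b by eventually_elim simp
    then show "s \<circ> \<psi> \<circ> \<phi> \<in> Linfty"
      by (rule LinftyI[OF measurable_comp[OF \<phi>m Linfty_measurable[OF s\<psi>]]])
    show "AE z in arc_measure. (s \<circ> \<psi> \<circ> \<phi>) z = s z"
      using inv(1) by eventually_elim simp
  qed fact
  ultimately show "\<alpha> s \<le> C" using inva[OF s\<psi>] by simp
qed

lemma alpha_bound_const: "c \<ge> 0 \<Longrightarrow> alpha_bound \<alpha> (\<lambda>_. c) c"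
  using alpha_bound_Linfty[OF Linfty_const[of "complex_of_real c"]]
    alpha_cmult[OF Linfty_const[of 1], of "complex_of_real c"] alpha_one by simp

lemma alpha_bound_cmult:
  assumes p: "alpha_bound \<alpha> p C" and "c \<ge> 0"
  shows "alpha_bound \<alpha> (\<lambda>z. c * p z) (c * C)"
  unfolding alpha_bound_def
proof (intro ballI impI)
  fix s assume s: "s \<in> Linfty" and le: "AE z in arc_measure. cmod (s z) \<le> c * p z"
  show "\<alpha> s \<le> c * C"
  proof (cases "c = 0")
    \<comment> \<open>Scaling by \<open>1 / c\<close> is impossible here, but the minorant is 0
      a.e., so its norm is 0.\<close>
    case True
    with le alpha_eq_0_iff[OF s] show ?thesis by simp
  next
    case False
    with \<open>c \<ge> 0\<close> have c: "c > 0" by simp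
    have "AE z in arc_measure. cmod (complex_of_real (1 / c) * s z) \<le> p z"
      using le by eventually_elim (use c in \<open>simp add: norm_mult norm_divide field_simps\<close>)
    then have "\<alpha> (\<lambda>z. complex_of_real (1 / c) * s z) \<le> C"
      by (rule alpha_boundD[OF p Linfty_cmult[OF s]])
    with c show ?thesis
      unfolding alpha_cmult[OF s] by (simp add: norm_divide field_simps)
  qed
qed

text \<open>A minorant of \<open>p + q\<close> is split in the proportion \<open>p : q\<close>; where \<open>p + q = 0\<close> both parts vanish
  by the convention \<open>x / 0 = 0\<close>.\<close>

lemma alpha_bound_add:
  assumes p: "alpha_bound \<alpha> p C" and q: "alpha_bound \<alpha> q D"
    and [measurable]: "p \<in> borel_measurable arc_measure" "q \<in> borel_measurable arc_measure"
    and nonneg: "\<And>z. 0 \<le> p z" "\<And>z. 0 \<le> q z"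
  shows "alpha_bound \<alpha> (\<lambda>z. p z + q z) (C + D)"
  unfolding alpha_bound_def
proof (intro ballI impI)
  fix s assume s: "s \<in> Linfty" and le: "AE z in arc_measure. cmod (s z) \<le> p z + q z"
  note [measurable] = s
  \<comment> \<open>Stated for a generic summand \<open>a\<close> so that it applies to
    \<open>p\<close> and \<open>q\<close> alike: \<open>a \<le> p + q\<close> keeps the factor
    within [0, 1], which preserves boundedness, and the minorant property of \<open>s\<close> bounds
    the product by \<open>a\<close>.\<close>
  have part: "\<alpha> (\<lambda>z. complex_of_real (a z / (p z + q z)) * s z) \<le> A
      \<and> (\<lambda>z. complex_of_real (a z / (p z + q z)) * s z) \<in> Linfty"
    if a: "alpha_bound \<alpha> a A" "\<And>z. 0 \<le> a z" "\<And>z. a z \<le> p z + q z"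
      and [measurable]: "a \<in> borel_measurable arc_measure" for a A
  proof (intro conjI)
    have quot: "0 \<le> a z / (p z + q z)" "a z / (p z + q z) \<le> 1" for z
      using a(2,3)[of z] nonneg[of z] by (auto simp: divide_le_eq_1)
    show L: "(\<lambda>z. complex_of_real (a z / (p z + q z)) * s z) \<in> Linfty"
    proof (rule Linfty_dominated[OF s])
      show "AE z in arc_measure.
          cmod (complex_of_real (a z / (p z + q z)) * s z) \<le> cmod (s z)"
        unfolding norm_mult norm_of_real abs_of_nonneg[OF quot(1)]
        using quot by (intro AE_I2 mult_left_le_one_le norm_ge_zero)
    qed measurable
    have "AE z in arc_measure. cmod (complex_of_real (a z / (p z + q z)) * s z) \<le> a z"
      using le
    proof eventually_elim
      case (elim z)
      have "cmod (complex_of_real (a z / (p z + q z)) * s z) = a z / (p z + q z) * cmod (s z)"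
        unfolding norm_mult norm_of_real abs_of_nonneg[OF quot(1)] ..
      also have "\<dots> \<le> a z / (p z + q z) * (p z + q z)"
        using elim quot(1) by (rule mult_left_mono)
      \<comment> \<open>Where \<open>p z + q z = 0\<close> the product is 0 and
        \<open>0 \<le> a z\<close> suffices; elsewhere equality holds.\<close>
      also have "\<dots> \<le> a z" using a(2)[of z] by simp
      finally show ?case .
    qed
    with a(1) L show "\<alpha> (\<lambda>z. complex_of_real (a z / (p z + q z)) * s z) \<le> A"
      by (rule alpha_boundD)
  qed
  define s1 where "s1 = (\<lambda>z. complex_of_real (p z / (p z + q z)) * s z)"
  define s2 where "s2 = (\<lambda>z. complex_of_real (q z / (p z + q z)) * s z)"
  have "\<alpha> s1 \<le> C \<and> s1 \<in> Linfty"
    unfolding s1_def by (rule part[OF p]) (simp_all add: nonneg)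
  then have s1: "s1 \<in> Linfty" "\<alpha> s1 \<le> C" by auto
  have "\<alpha> s2 \<le> D \<and> s2 \<in> Linfty"
    unfolding s2_def by (rule part[OF q]) (simp_all add: nonneg)
  then have s2: "s2 \<in> Linfty" "\<alpha> s2 \<le> D" by auto
  have "AE z in arc_measure. s z = s1 z + s2 z"
    using le
  proof eventually_elim
    case (elim z)
    show ?case
    proof (cases "p z + q z = 0")
      case True
      with elim show ?thesis by (simp add: s1_def s2_def)
    next
      case False
      then have "p z / (p z + q z) + q z / (p z + q z) = 1"
        by (simp add: add_divide_distrib[symmetric])
      then have "complex_of_real (p z / (p z + q z)) + complex_of_real (q z / (p z + q z)) = 1"
        by (metis of_real_add of_real_1)
      then show ?thesis
        unfolding s1_def s2_def by (metis distrib_right mult_1)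
    qed
  qed
  then have "\<alpha> s = \<alpha> (\<lambda>z. s1 z + s2 z)"
    by (rule alpha_cong_AE[OF s Linfty_add[OF s1(1) s2(1)]])
  also have "\<dots> \<le> C + D"
    using alpha_add[OF s1(1) s2(1)] s1(2) s2(2) by simp
  finally show "\<alpha> s \<le> C + D" .
qed

text \<open>Bounded functions are uniform limits of simple minorants (round \<open>|h|\<close> down to a multiple of
  \<open>\<delta>\<close>), so passing from simple to bounded minorants does not increase the supremum.\<close>

lemma alpha_bound_ext_norm:
  assumes "ext_norm \<alpha> f \<le> ereal C"
  shows "alpha_bound \<alpha> (\<lambda>z. cmod (f z)) C"
  unfolding alpha_bound_def
proof (intro ballI impI)
  fix h assume h: "h \<in> Linfty" and le: "AE z in arc_measure. cmod (h z) \<le> cmod (f z)"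
  note [measurable] = h
  obtain b where b: "b > 0" "AE z in arc_measure. cmod (h z) \<le> b" using h by (rule LinftyE)
  show "\<alpha> h \<le> C"
  proof (rule field_le_epsilon)
    fix \<delta> :: real assume \<delta>: "\<delta> > 0"
    \<comment> \<open>\<open>h\<close> is bounded by \<open>b\<close> only a.e.; capping at
      \<open>b\<close> bounds \<open>t\<close> everywhere, so that its floor takes finitely many
      values.\<close>
    define t where "t z = min (cmod (h z)) b / \<delta>" for z
    have [measurable]: "t \<in> borel_measurable arc_measure" unfolding t_def by measurable
    have t: "0 \<le> t z" "t z \<le> b / \<delta>" for z
      using b \<delta> by (auto simp: t_def divide_right_mono)
    define s where "s z = complex_of_real (\<delta> * of_int \<lfloor>t z\<rfloor>)" for z
    have simple: "simple_function arc_measure s"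
    proof -
      have s_meas: "s \<in> borel_measurable arc_measure" unfolding s_def by measurable
      have "s ` space arc_measure \<subseteq> (\<lambda>k. complex_of_real (\<delta> * of_int k)) ` {0..\<lfloor>b / \<delta>\<rfloor>}"
        unfolding s_def using t by (auto intro!: imageI floor_mono)
      then have "finite (s ` space arc_measure)"
        by (rule finite_subset) auto
      with s_meas show "simple_function arc_measure s"
        by (rule simple_function_borel_measurable)
    qed
    have cmod_s: "cmod (s z) = \<delta> * of_int \<lfloor>t z\<rfloor>" for z
      using t(1)[of z] \<delta> unfolding s_def norm_of_real by simp
    have s_le: "cmod (s z) \<le> cmod (h z)" for z
    proof -
      have "\<delta> * of_int \<lfloor>t z\<rfloor> \<le> \<delta> * t z" using \<delta> by (intro mult_left_mono) auto
      also have "\<dots> \<le> cmod (h z)" using \<delta> by (simp add: t_def)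
      finally show ?thesis by (simp add: cmod_s)
    qed
    have "AE z in arc_measure. cmod (s z) \<le> cmod (f z)"
      using le by eventually_elim (rule order_trans[OF s_le])
    with simple have "ereal (\<alpha> s) \<le> ext_norm \<alpha> f"
      unfolding ext_norm_def by (intro SUP_upper) simp
    from order_trans[OF this assms] have \<alpha>s: "\<alpha> s \<le> C" by simp
    have sL: "s \<in> Linfty" using simple by (rule Linfty_simple_function)
    note [measurable] = sL
    \<comment> \<open>The floor loses less than one step of size \<delta>, so
      \<open>|h| \<le> |s| + \<delta>\<close> a.e.; this bound turns that into
      \<open>\<alpha> h \<le> \<alpha> s + \<delta>\<close>.\<close>
    have "alpha_bound \<alpha> (\<lambda>z. cmod (s z) + \<delta>) (\<alpha> s + \<delta>)"
      using \<delta> by (intro alpha_bound_add alpha_bound_Linfty alpha_bound_const sL) auto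
    moreover have "AE z in arc_measure. cmod (h z) \<le> cmod (s z) + \<delta>"
      using b(2)
    proof eventually_elim
      case (elim z)
      then have "cmod (h z) = \<delta> * t z" using \<delta> by (simp add: t_def)
      also have "\<dots> \<le> \<delta> * (of_int \<lfloor>t z\<rfloor> + 1)"
        using \<delta> by (intro mult_left_mono) linarith+
      finally show ?case by (simp add: cmod_s algebra_simps)
    qed
    ultimately have "\<alpha> h \<le> \<alpha> s + \<delta>" by (rule alpha_boundD[OF _ h])
    with \<alpha>s show "\<alpha> h \<le> C + \<delta>" by simp
  qed
qed

text \<open>The zero function is a simple minorant of every \<open>f\<close>.\<close>

lemma ext_norm_nonneg: "0 \<le> ext_norm \<alpha> f"
proof -
  have "\<alpha> (\<lambda>_. 0) = 0"
    using alpha_eq_0_iff[OF Linfty_const[of 0]] by simp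
  moreover have "ereal (\<alpha> (\<lambda>_. 0)) \<le> ext_norm \<alpha> f"
    unfolding ext_norm_def by (rule SUP_upper) simp
  ultimately show ?thesis by (simp add: zero_ereal_def)
qed

section \<open>Continuity of \<alpha> and limits in measure\<close>

text \<open>The continuity axiom speaks only of sets of positive measure; definiteness supplies the
  null sets.\<close>

lemma alpha_indicator_small:
  assumes "\<epsilon> > 0"
  obtains \<delta> where "\<delta> > 0"
    "\<And>E. E \<in> sets arc_measure \<Longrightarrow> measure arc_measure E < \<delta> \<Longrightarrow> \<alpha> (indicator E) < \<epsilon>"
proof -
  obtain \<delta> where \<delta>: "\<delta> > 0" "\<And>E. E \<in> sets arc_measure \<Longrightarrow> 0 < measure arc_measure E \<Longrightarrow>
      measure arc_measure E < \<delta> \<Longrightarrow> \<alpha> (indicator E) < \<epsilon>"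
    using rotsym_norm assms unfolding continuous_rotsym_norm_def by meson
  have "\<alpha> (indicator E) < \<epsilon>" if E: "E \<in> sets arc_measure" "measure arc_measure E < \<delta>" for E
  proof (cases "measure arc_measure E = 0")
    case True
    then have "E \<in> null_sets arc_measure"
      using E(1) by (simp add: null_sets_def arc.emeasure_eq_measure)
    then have "AE z in arc_measure. indicator E z = (0 :: complex)"
      by (auto dest!: AE_not_in elim!: eventually_mono simp: indicator_def)
    with alpha_eq_0_iff[OF Linfty_indicator[OF E(1)]] assms show ?thesis by simp
  next
    case False
    with E show ?thesis by (intro \<delta>(2)) (auto simp: zero_less_measure_iff)
  qed
  with \<delta>(1) show thesis by (rule that)
qed

lemma alpha_bound_indicator:
  assumes "E \<in> sets arc_measure" "b \<ge> 0"
  shows "alpha_bound \<alpha> (\<lambda>z. b * indicator E z) (b * \<alpha> (indicator E))"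
proof -
  have "cmod (indicator E z) = indicator E z" for z by (simp add: indicator_def)
  with alpha_bound_Linfty[OF Linfty_indicator[OF assms(1)]]
  have "alpha_bound \<alpha> (indicator E) (\<alpha> (indicator E))" by simp
  then show ?thesis using assms(2) by (rule alpha_bound_cmult)
qed

text \<open>A Fatou property. A bounded minorant \<open>s\<close> of \<open>p\<close> satisfies
  \<open>|s| \<le> q + \<eta> + b * indicator E\<close> a.e., where \<open>E\<close> is the set on
  which \<open>q\<close> and \<open>p\<close> differ by at least \<eta>. On \<open>E\<close> only
  the bound \<open>b\<close> of \<open>s\<close> is used, and \<alpha> of the indicator is small
  because \<open>E\<close> has small measure.\<close>

lemma alpha_bound_limit_in_measure:
  assumes [measurable]: "p \<in> borel_measurable arc_measure"
    and approx: "\<And>\<eta>. \<eta> > 0 \<Longrightarrow> \<exists>q \<in> borel_measurable arc_measure. alpha_bound \<alpha> q C \<and> (\<forall>z. 0 \<le> q z) \<and>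
      measure arc_measure {z \<in> space arc_measure. \<eta> \<le> \<bar>q z - p z\<bar>} < \<eta>"
  shows "alpha_bound \<alpha> p C"
  unfolding alpha_bound_def
proof (intro ballI impI)
  fix s assume s: "s \<in> Linfty" and le: "AE z in arc_measure. cmod (s z) \<le> p z"
  obtain b where b: "b > 0" "AE z in arc_measure. cmod (s z) \<le> b" using s by (rule LinftyE)
  show "\<alpha> s \<le> C"
  proof (rule field_le_epsilon)
    fix e :: real assume e: "e > 0"
    obtain \<delta> where \<delta>: "\<delta> > 0" "\<And>E. E \<in> sets arc_measure \<Longrightarrow> measure arc_measure E < \<delta> \<Longrightarrow>
        \<alpha> (indicator E) < e / (2 * b)"
      using alpha_indicator_small[of "e / (2 * b)"] e b(1) by auto
    \<comment> \<open>\<eta> is both the tolerance and the bound on the measure of \<open>E\<close>: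
      \<open>\<eta> \<le> \<delta>\<close> makes the indicator term at most \<open>e / 2\<close>,
      and \<open>\<eta> \<le> e / 2\<close> covers the uniform error.\<close>
    define \<eta> where "\<eta> = min \<delta> (e / 2)"
    have \<eta>: "\<eta> > 0" "\<eta> \<le> \<delta>" "\<eta> \<le> e / 2" using \<delta>(1) e by (auto simp: \<eta>_def)
    obtain q where [measurable]: "q \<in> borel_measurable arc_measure" and q: "alpha_bound \<alpha> q C"
      "\<And>z. 0 \<le> q z" "measure arc_measure {z \<in> space arc_measure. \<eta> \<le> \<bar>q z - p z\<bar>} < \<eta>"
      using approx[OF \<eta>(1)] by blast
    define E where "E = {z \<in> space arc_measure. \<eta> \<le> \<bar>q z - p z\<bar>}"
    have E [measurable]: "E \<in> sets arc_measure" unfolding E_def by measurable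
    have "\<alpha> (indicator E) < e / (2 * b)"
      using q(3) \<eta> by (intro \<delta>(2) E) (simp add: E_def)
    then have small: "b * \<alpha> (indicator E) \<le> e / 2"
      using b(1) by (simp add: field_simps)
    have "alpha_bound \<alpha> (\<lambda>z. q z + (\<eta> + b * indicator E z)) (C + (\<eta> + b * \<alpha> (indicator E)))"
      using q \<eta>(1) b(1)
      by (intro alpha_bound_add alpha_bound_const alpha_bound_indicator E) auto
    moreover have "AE z in arc_measure. cmod (s z) \<le> q z + (\<eta> + b * indicator E z)"
      using le b(2) AE_space
    proof eventually_elim
      case (elim z)
      show ?case
      proof (cases "z \<in> E")
        case True
        then show ?thesis using elim(2) q(2)[of z] \<eta>(1) by simp
      next
        case False
        then have "\<bar>q z - p z\<bar> < \<eta>" using elim(3) by (auto simp: E_def)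
        with False elim(1) show ?thesis by simp
      qed
    qed
    ultimately have "\<alpha> s \<le> C + (\<eta> + b * \<alpha> (indicator E))"
      by (rule alpha_boundD[OF _ s])
    with small \<eta>(3) show "\<alpha> s \<le> C + e" by simp
  qed
qed

section \<open>Functions with small tails\<close>

text \<open>An \<alpha>-version of uniform integrability: a family has it when each
  \<open>\<epsilon> > 0\<close> admits a single \<open>M\<close> for all its members.\<close>

definition tail_bound :: "real \<Rightarrow> real \<Rightarrow> (complex \<Rightarrow> complex) set"
  where "tail_bound M \<epsilon> = {k \<in> borel_measurable arc_measure.
    alpha_bound \<alpha> (\<lambda>z. max 0 (cmod (k z) - M)) \<epsilon>}"

lemma tail_boundD:
  assumes "k \<in> tail_bound M \<epsilon>"
  shows "k \<in> borel_measurable arc_measure" "alpha_bound \<alpha> (\<lambda>z. max 0 (cmod (k z) - M)) \<epsilon>"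
  using assms by (auto simp: tail_bound_def)

text \<open>\<open>max 0 (t - M)\<close> is increasing and convex in \<open>t\<close>, so the tail
  of a convex combination is at most the same combination of the tails.\<close>

lemma convex_tail_bound: "convex (tail_bound M \<epsilon>)"
proof (rule convexI)
  fix k l :: "complex \<Rightarrow> complex" and a b :: real
  assume k: "k \<in> tail_bound M \<epsilon>" and l: "l \<in> tail_bound M \<epsilon>"
    and ab: "0 \<le> a" "0 \<le> b" "a + b = 1"
  note [measurable] = tail_boundD(1)[OF k] tail_boundD(1)[OF l]
  have eq: "a *\<^sub>R k + b *\<^sub>R l = (\<lambda>z. a *\<^sub>R k z + b *\<^sub>R l z)"
    by (simp add: fun_eq_iff scaleR_fun_def)
  have "alpha_bound \<alpha> (\<lambda>z. a * max 0 (cmod (k z) - M) + b * max 0 (cmod (l z) - M))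
      (a * \<epsilon> + b * \<epsilon>)"
    using ab by (intro alpha_bound_add alpha_bound_cmult tail_boundD k l) auto
  moreover have "a * \<epsilon> + b * \<epsilon> = \<epsilon>"
    using ab(3) by (metis distrib_right mult_1)
  moreover have "max 0 (cmod (a *\<^sub>R k z + b *\<^sub>R l z) - M)
      \<le> a * max 0 (cmod (k z) - M) + b * max 0 (cmod (l z) - M)" for z
  proof -
    have "cmod (a *\<^sub>R k z + b *\<^sub>R l z) \<le> a * cmod (k z) + b * cmod (l z)"
      using norm_triangle_ineq[of "a *\<^sub>R k z" "b *\<^sub>R l z"] ab by simp
    moreover have "a * (cmod (k z) - M) + b * (cmod (l z) - M)
        = a * cmod (k z) + b * cmod (l z) - (a + b) * M"
      by (simp add: algebra_simps)
    moreover have "a * (cmod (k z) - M) \<le> a * max 0 (cmod (k z) - M)"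
      "b * (cmod (l z) - M) \<le> b * max 0 (cmod (l z) - M)"
      "0 \<le> a * max 0 (cmod (k z) - M)" "0 \<le> b * max 0 (cmod (l z) - M)"
      using ab by (auto intro!: mult_left_mono)
    ultimately show ?thesis using ab(3) by simp
  qed
  ultimately show "a *\<^sub>R k + b *\<^sub>R l \<in> tail_bound M \<epsilon>"
    unfolding eq tail_bound_def by (auto intro: alpha_bound_mono)
qed

text \<open>\<open>max 0 (t - M)\<close> is 1-Lipschitz in \<open>t\<close>, so closeness of
  \<open>k\<close> to \<open>f\<close> in measure passes to their tails.\<close>

lemma tail_bound_closed:
  assumes [measurable]: "f \<in> borel_measurable arc_measure"
    and approx: "\<And>\<eta>. \<eta> > 0 \<Longrightarrow> \<exists>k\<in>tail_bound M \<epsilon>. k \<in> measure_nbhd f \<eta>"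
  shows "f \<in> tail_bound M \<epsilon>"
proof -
  have "alpha_bound \<alpha> (\<lambda>z. max 0 (cmod (f z) - M)) \<epsilon>"
  proof (rule alpha_bound_limit_in_measure)
    fix \<eta> :: real assume "\<eta> > 0"
    from approx[OF this] obtain k where k: "k \<in> tail_bound M \<epsilon>" and "k \<in> measure_nbhd f \<eta>"
      by blast
    then have near: "measure arc_measure {z \<in> space arc_measure. \<eta> \<le> cmod (k z - f z)} < \<eta>"
      by (simp add: measure_nbhd_def)
    note [measurable] = tail_boundD(1)[OF k]
    let ?q = "\<lambda>z. max 0 (cmod (k z) - M)"
    have lip: "\<bar>?q z - max 0 (cmod (f z) - M)\<bar> \<le> cmod (k z - f z)" for z
      using norm_triangle_ineq3[of "k z" "f z"] by linarith
    have "measure arc_measure {z \<in> space arc_measure. \<eta> \<le> \<bar>?q z - max 0 (cmod (f z) - M)\<bar>}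
        \<le> measure arc_measure {z \<in> space arc_measure. \<eta> \<le> cmod (k z - f z)}"
      by (rule arc.finite_measure_mono) (auto intro: order_trans[OF _ lip])
    with near tail_boundD(2)[OF k]
    show "\<exists>q \<in> borel_measurable arc_measure. alpha_bound \<alpha> q \<epsilon> \<and> (\<forall>z. 0 \<le> q z) \<and>
        measure arc_measure {z \<in> space arc_measure. \<eta> \<le> \<bar>q z - max 0 (cmod (f z) - M)\<bar>} < \<eta>"
      by (intro bexI[of _ ?q]) auto
  qed measurable
  then show ?thesis by (simp add: tail_bound_def)
qed

text \<open>Take a bounded \<open>h\<close> within \<epsilon> of \<open>g\<close> and let
  \<open>M\<close> be an essential bound of \<open>h\<close>; then
  \<open>|g| - M \<le> |g| - |h| \<le> |g - h|\<close> a.e.\<close>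

lemma L_space_tail_bound:
  assumes "g \<in> L_space \<alpha>" "\<epsilon> > 0"
  obtains M where "M > 0" "g \<in> tail_bound M \<epsilon>"
proof -
  obtain h where h: "h \<in> Linfty" "ext_norm \<alpha> (\<lambda>z. g z - h z) < ereal \<epsilon>"
    using assms by (auto simp: L_space_def)
  obtain M where M: "M > 0" "AE z in arc_measure. cmod (h z) \<le> M"
    using h(1) by (rule LinftyE)
  have "alpha_bound \<alpha> (\<lambda>z. cmod (g z - h z)) \<epsilon>"
    using h(2) by (intro alpha_bound_ext_norm) simp
  moreover have "AE z in arc_measure. max 0 (cmod (g z) - M) \<le> cmod (g z - h z)"
    using M(2) by eventually_elim (use norm_triangle_ineq2 in \<open>smt (verit) norm_ge_zero\<close>)
  ultimately have "alpha_bound \<alpha> (\<lambda>z. max 0 (cmod (g z) - M)) \<epsilon>"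
    by (rule alpha_bound_mono) simp
  with assms(1) M(1) show thesis
    by (intro that[of M]) (auto simp: tail_bound_def L_space_def cal_L_def)
qed

text \<open>These functions generate \<open>K\<close>. A factor of modulus at most 1 can only shrink
  the tail, and composition with \<phi> keeps its bound.\<close>

lemma tail_bound_compose_mult:
  assumes g: "g \<in> tail_bound M \<epsilon>" and \<phi>: "\<phi> \<in> G_set \<alpha>"
    and u: "u \<in> Linfty" "Linfty_norm u \<le> 1"
  shows "(\<lambda>z. complex_of_real (cmod ((g \<circ> \<phi>) z)) * u z) \<in> tail_bound M \<epsilon>"
proof -
  note [measurable] = tail_boundD(1)[OF g] u(1)
  have [measurable]: "\<phi> \<in> arc_measure \<rightarrow>\<^sub>M arc_measure"
    using \<phi> by (simp add: G_set_def MP_def)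
  have "AE z in arc_measure. ereal (cmod (u z)) \<le> Linfty_norm u"
    unfolding Linfty_norm_def by (rule esssup_AE)
  then have le1: "AE z in arc_measure. cmod (u z) \<le> 1"
    by eventually_elim (use u(2) order_trans in fastforce)
  have "AE z in arc_measure. max 0 (cmod (complex_of_real (cmod ((g \<circ> \<phi>) z)) * u z) - M)
      \<le> max 0 (cmod (g (\<phi> z)) - M)"
    using le1
  proof eventually_elim
    case (elim z)
    then have "cmod (g (\<phi> z)) * cmod (u z) \<le> cmod (g (\<phi> z))"
      by (intro mult_left_le) auto
    then show ?case by (simp add: norm_mult)
  qed
  with alpha_bound_compose[OF tail_boundD(2)[OF g] \<phi>]
  have "alpha_bound \<alpha> (\<lambda>z. max 0 (cmod (complex_of_real (cmod ((g \<circ> \<phi>) z)) * u z) - M)) \<epsilon>"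
    by (rule alpha_bound_mono) simp
  moreover have "(\<lambda>z. complex_of_real (cmod ((g \<circ> \<phi>) z)) * u z) \<in> borel_measurable arc_measure"
    unfolding comp_def by measurable
  ultimately show ?thesis by (simp add: tail_bound_def)
qed

section \<open>From small tails to membership and norm convergence\<close>

text \<open>Adding \<open>M\<close> to the tail dominates \<open>|f|\<close>, which gives a finite
  norm. The bounded approximant cuts the modulus of \<open>f\<close> down to \<open>M\<close> and
  keeps its argument; the remainder has the tail as its modulus.\<close>

lemma L_spaceI:
  assumes f [measurable]: "f \<in> borel_measurable arc_measure"
    and tail: "\<And>\<epsilon>. \<epsilon> > 0 \<Longrightarrow> \<exists>M>0. f \<in> tail_bound M \<epsilon>"
  shows "f \<in> L_space \<alpha>"
proof -
  obtain M where M: "M > 0" "f \<in> tail_bound M 1" using tail[of 1] by auto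
  have "alpha_bound \<alpha> (\<lambda>z. M + max 0 (cmod (f z) - M)) (M + 1)"
    using M by (intro alpha_bound_add alpha_bound_const tail_boundD) auto
  then have "alpha_bound \<alpha> (\<lambda>z. cmod (f z)) (M + 1)"
    by (rule alpha_bound_mono) auto
  then have "ext_norm \<alpha> f \<le> ereal (M + 1)"
    by (rule ext_norm_le_alpha_bound)
  then have "f \<in> cal_L \<alpha>"
    using f by (auto simp: cal_L_def)
  moreover have "\<exists>h\<in>Linfty. ext_norm \<alpha> (\<lambda>z. f z - h z) < ereal \<epsilon>" if "\<epsilon> > 0" for \<epsilon>
  proof -
    \<comment> \<open>The half leaves room for the strict inequality, since bounds on the norm come
      out non-strict.\<close>
    obtain M where M: "M > 0" "f \<in> tail_bound M (\<epsilon> / 2)"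
      using tail[of "\<epsilon> / 2"] \<open>\<epsilon> > 0\<close> by auto
    \<comment> \<open>At zeros of \<open>f\<close> division by 0 gives \<open>c z = 0\<close>, hence
      the disjunction in \<open>c_small\<close>; \<open>c\<close> matters only as a factor of
      \<open>f\<close>.\<close>
    define c where "c z = min 1 (M / cmod (f z))" for z
    have c_small: "f z = 0 \<or> c z = 1" if "cmod (f z) \<le> M" for z
      using that M(1) unfolding c_def by (cases "f z = 0") (auto simp: le_divide_eq)
    have c_large: "c z * cmod (f z) = M" "0 \<le> c z" "c z \<le> 1" if "M < cmod (f z)" for z
      using that M(1) unfolding c_def by (auto simp: min_def divide_le_eq)
    have [measurable]: "c \<in> borel_measurable arc_measure"
      unfolding c_def by measurable
    have h: "cmod (complex_of_real (c z) * f z) \<le> M" for z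
    proof (cases "cmod (f z) \<le> M")
      case True
      then show ?thesis using c_small[OF True] M(1) by auto
    next
      case False
      then show ?thesis using c_large[of z] by (simp add: norm_mult)
    qed
    have r: "cmod (f z - complex_of_real (c z) * f z) \<le> max 0 (cmod (f z) - M)" for z
    proof -
      have "f z - complex_of_real (c z) * f z = complex_of_real (1 - c z) * f z"
        by (simp add: left_diff_distrib)
      then have "cmod (f z - complex_of_real (c z) * f z) = \<bar>1 - c z\<bar> * cmod (f z)"
        by (simp only: norm_mult norm_of_real)
      also have "\<dots> \<le> max 0 (cmod (f z) - M)"
      proof (cases "cmod (f z) \<le> M")
        case True
        then show ?thesis using c_small[OF True] by auto
      next
        case False
        then show ?thesis using c_large[of z] by (simp add: left_diff_distrib)
      qed
      finally show ?thesis .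
    qed
    have "alpha_bound \<alpha> (\<lambda>z. cmod (f z - complex_of_real (c z) * f z)) (\<epsilon> / 2)"
      using tail_boundD(2)[OF M(2)] by (rule alpha_bound_mono) (use r in auto)
    then have "ext_norm \<alpha> (\<lambda>z. f z - complex_of_real (c z) * f z) \<le> ereal (\<epsilon> / 2)"
      by (rule ext_norm_le_alpha_bound)
    also have "\<dots> < ereal \<epsilon>" using that by simp
    finally have "ext_norm \<alpha> (\<lambda>z. f z - complex_of_real (c z) * f z) < ereal \<epsilon>" .
    moreover have "(\<lambda>z. complex_of_real (c z) * f z) \<in> Linfty"
    proof (rule LinftyI)
      show "AE z in arc_measure. cmod (complex_of_real (c z) * f z) \<le> M"
        by (rule AE_I2) (rule h)
    qed measurable
    ultimately show ?thesis by (rule bexI)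
  qed
  ultimately show ?thesis by (simp add: L_space_def)
qed

lemma ext_norm_diff_tendsto_0:
  assumes lim: "tendsto_in_measure F f"
    and tail: "\<And>\<epsilon>. \<epsilon> > 0 \<Longrightarrow> \<exists>M>0. f \<in> tail_bound M \<epsilon> \<and> (\<forall>n. F n \<in> tail_bound M \<epsilon>)"
  shows "(\<lambda>n. ext_norm \<alpha> (\<lambda>z. F n z - f z)) \<longlonglongrightarrow> 0"
proof -
  have [measurable]: "F n \<in> borel_measurable arc_measure" "f \<in> borel_measurable arc_measure" for n
    using lim by (auto simp: tendsto_in_measure_def)
  have ev: "eventually (\<lambda>n. ext_norm \<alpha> (\<lambda>z. F n z - f z) \<le> ereal e) sequentially"
    if e: "e > 0" for e
  proof -
    \<comment> \<open>Four terms share \<open>e\<close>: the uniform error \<open>e / 4\<close>, the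
      part on \<open>E n\<close> with \<open>2 * M * (e / (8 * M)) = e / 4\<close>, and the two
      tails.\<close>
    obtain M where M: "M > 0" "f \<in> tail_bound M (e / 4)" "\<And>n. F n \<in> tail_bound M (e / 4)"
      using tail[of "e / 4"] e by auto
    obtain \<delta> where \<delta>: "\<delta> > 0" "\<And>E. E \<in> sets arc_measure \<Longrightarrow> measure arc_measure E < \<delta> \<Longrightarrow>
        \<alpha> (indicator E) < e / (8 * M)"
      using alpha_indicator_small[of "e / (8 * M)"] e M(1) by auto
    define E where "E n = {z \<in> space arc_measure. e / 4 \<le> cmod (F n z - f z)}" for n
    have E [measurable]: "E n \<in> sets arc_measure" for n unfolding E_def by measurable
    have "(\<lambda>n. measure arc_measure (E n)) \<longlonglongrightarrow> 0"
      unfolding E_def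
      using lim[unfolded tendsto_in_measure_def, THEN conjunct2, THEN conjunct2, rule_format, of "e / 4"] e
      by simp
    then have "eventually (\<lambda>n. measure arc_measure (E n) < \<delta>) sequentially"
      using \<delta>(1) by (rule order_tendstoD(2))
    then show ?thesis
    proof eventually_elim
      case (elim n)
      then have "\<alpha> (indicator (E n)) < e / (8 * M)" by (intro \<delta>(2) E)
      then have small: "2 * M * \<alpha> (indicator (E n)) \<le> e / 4"
        using M(1) by (simp add: field_simps)
      have "alpha_bound \<alpha> (\<lambda>z. (e / 4 + 2 * M * indicator (E n) z)
            + (max 0 (cmod (F n z) - M) + max 0 (cmod (f z) - M)))
          ((e / 4 + 2 * M * \<alpha> (indicator (E n))) + (e / 4 + e / 4))"
        using e M
        by (intro alpha_bound_add alpha_bound_const alpha_bound_indicator E tail_boundD) auto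
      moreover have "AE z in arc_measure. cmod (F n z - f z) \<le>
          (e / 4 + 2 * M * indicator (E n) z)
            + (max 0 (cmod (F n z) - M) + max 0 (cmod (f z) - M))"
      proof (rule AE_I2)
        fix z assume z: "z \<in> space arc_measure"
        show "cmod (F n z - f z) \<le> (e / 4 + 2 * M * indicator (E n) z)
            + (max 0 (cmod (F n z) - M) + max 0 (cmod (f z) - M))"
        proof (cases "z \<in> E n")
          case True
          then show ?thesis
            using norm_triangle_ineq4[of "F n z" "f z"] e by simp
        next
          case False
          then have "cmod (F n z - f z) < e / 4" using z by (simp add: E_def)
          with False show ?thesis by simp
        qed
      qed
      ultimately have "alpha_bound \<alpha> (\<lambda>z. cmod (F n z - f z)) e"
        by (rule alpha_bound_mono) (use small in simp)
      then show ?case by (rule ext_norm_le_alpha_bound)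
    qed
  qed
  show ?thesis
  proof (rule order_tendstoI)
    fix a :: ereal assume "a < 0"
    then show "eventually (\<lambda>n. a < ext_norm \<alpha> (\<lambda>z. F n z - f z)) sequentially"
      by (intro always_eventually allI) (rule less_le_trans[OF _ ext_norm_nonneg])
  next
    fix a :: ereal assume "0 < a"
    \<comment> \<open>\<open>ev\<close> yields a non-strict bound by a real number, so a real
      \<open>e\<close> is placed strictly between 0 and \<open>a\<close>, which may be
      infinite.\<close>
    then obtain e where "0 < ereal e" "ereal e < a" using ereal_dense2 by blast
    then show "eventually (\<lambda>n. ext_norm \<alpha> (\<lambda>z. F n z - f z) < a) sequentially"
      using ev[of e] by (auto elim!: eventually_mono)
  qed
qed

end

section \<open>Uniform tails of the sequence and of its limit\<close>

theorem theorem4p3: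
  fixes \<alpha> :: "(complex \<Rightarrow> complex) \<Rightarrow> real"
    and g f :: "complex \<Rightarrow> complex"
    and F :: "nat \<Rightarrow> complex \<Rightarrow> complex"
    and K :: "(complex \<Rightarrow> complex) set"
  assumes "continuous_rotsym_norm \<alpha>"
    and "g \<in> L_space \<alpha>"
    and "K = convex hull
      {(\<lambda>z. complex_of_real (cmod ((g \<circ> \<phi>) z)) * u z) | u \<phi>.
         u \<in> Linfty \<and> Linfty_norm u \<le> 1 \<and> \<phi> \<in> G_set \<alpha>}"
    and "\<And>n. (\<lambda>z. complex_of_real (cmod (F n z))) \<in> measure_topology closure_of K"
    and "tendsto_in_measure F f"
  shows "f \<in> L_space \<alpha> \<and> (\<lambda>n. ext_norm \<alpha> (\<lambda>z. F n z - f z)) \<longlonglongrightarrow> 0"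
proof -
  interpret rotsym_norm \<alpha> by standard (fact assms(1))
  have F [measurable]: "F n \<in> borel_measurable arc_measure"
    and f [measurable]: "f \<in> borel_measurable arc_measure" for n
    using assms(5) by (auto simp: tendsto_in_measure_def)
  \<comment> \<open>For given \<epsilon>, one \<open>M\<close> chosen from \<open>g\<close> alone
    serves \<open>f\<close> and all \<open>F n\<close>.\<close>
  have tail: "\<exists>M>0. f \<in> tail_bound M \<epsilon> \<and> (\<forall>n. F n \<in> tail_bound M \<epsilon>)" if "\<epsilon> > 0" for \<epsilon>
  proof -
    obtain M where M: "M > 0" "g \<in> tail_bound M \<epsilon>"
      using L_space_tail_bound[OF assms(2) \<open>\<epsilon> > 0\<close>] .
    have "K \<subseteq> tail_bound M \<epsilon>"
      unfolding assms(3) using M(2)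
      by (intro hull_minimal convex_tail_bound) (auto intro: tail_bound_compose_mult simp del: comp_apply)
    then have "(\<lambda>z. complex_of_real (cmod (F n z))) \<in> tail_bound M \<epsilon>" for n
      using assms(4)[of n] unfolding in_closure_measure_topology
      by (intro tail_bound_closed) blast+
    \<comment> \<open>Apart from measurability, membership in \<open>tail_bound\<close> depends only
      on the modulus.\<close>
    then have Fn: "F n \<in> tail_bound M \<epsilon>" for n
      using F by (simp add: tail_bound_def)
    \<comment> \<open>The closure of \<open>K\<close> is known to contain only the moduli of the
      \<open>F n\<close>, so \<open>f\<close> is reached through the \<open>F n\<close> themselves,
      which lie in \<open>tail_bound M \<epsilon>\<close> and converge to \<open>f\<close> in
      measure.\<close>
    have "f \<in> tail_bound M \<epsilon>"
    proof (rule tail_bound_closed[OF f])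
      fix \<eta> :: real assume "\<eta> > 0"
      with assms(5) have "(\<lambda>n. measure arc_measure {z \<in> space arc_measure. \<eta> \<le> cmod (F n z - f z)}) \<longlonglongrightarrow> 0"
        by (simp add: tendsto_in_measure_def)
      then have "eventually (\<lambda>n. measure arc_measure
          {z \<in> space arc_measure. \<eta> \<le> cmod (F n z - f z)} < \<eta>) sequentially"
        using \<open>\<eta> > 0\<close> by (rule order_tendstoD(2))
      then obtain n where "measure arc_measure {z \<in> space arc_measure. \<eta> \<le> cmod (F n z - f z)} < \<eta>"
        using eventually_happens'[OF sequentially_bot] by blast
      then show "\<exists>k\<in>tail_bound M \<epsilon>. k \<in> measure_nbhd f \<eta>"
        using Fn F by (intro bexI[of _ "F n"]) (auto simp: measure_nbhd_def)
    qed
    with M(1) Fn show ?thesis by blast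
  qed
  then have "f \<in> L_space \<alpha>"
    by (intro L_spaceI f) blast
  with ext_norm_diff_tendsto_0[OF assms(5) tail] show ?thesis by simp
qed

end
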